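(* Let $n\ge2$ and $0\le m\le n$ be integers. For each integer threshold $a\in\{-(n-m)+1,\dots,m-1\}$ let $\bar T(a)$ be the mean stopping time of the bit-exchange protocol with $n$ nodes, $m$ positive weights and threshold $a$. Then the vector of mean stopping times $\bar{\mathbf T}=(\bar T(-(n-m)+1),\dots,\bar T(m-1))^t$ is a solution of $$(\mathbf I-\mathbf Q)\,\bar{\mathbf T}=(1,1,\dots,1)^t,$$ where $\mathbf I$ is the $(n-1)\times(n-1)$ identity matrix and $\mathbf Q$ is the $(n-1)\times(n-1)$ matrix, with rows and columns indexed by $\{-(n-m)+1,\dots,m-1\}$, whose entry in row $a$ and column $a'$ is $\Pr[B(l)=2a-a']$ (this probability does not depend on $l\ge1$).
   Context: Setting: $n$ nodes; node $i$ alone knows $X_i$, and $X_1,\dots,X_n$ are i.i.d. uniform on $[0,1)$. Weights $h_i\in\{-1,+1\}$; $\mathcal H^{+}=\{i:h_i=+1\}$, $\mathcal H^{-}=\{i:h_i=-1\}$, $m=|\mathcal H^+|$, so $|\mathcal H^-|=n-m$. For each $i$, $b(i,1),b(i,2),\dots\in\{0,1\}$ are the standard binary expansion digits of $X_i$: $X(i,1)=X_i$, $b(i,j)=\lfloor 2X(i,j)\rfloor$, $X(i,j+1)=2X(i,j)-b(i,j)$. Let $B(l)=\sum_{i\in\mathcal H^+}b(i,l)-\sum_{i\in\mathcal H^-}b(i,l)$ and $Z(j)=\sum_{l=1}^jB(l)2^{-l}$. For a threshold $a$ let $L(j)=a-m2^{-j}$ and $U(j)=a+(n-m)2^{-j}$.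 The bit-exchange protocol stops after round $j$ if $Z(j)\le L(j)$ or $Z(j)\ge U(j)$, and otherwise continues. The stopping time $T$ is the smallest $j\ge1$ at which the protocol stops, and the mean stopping time for threshold $a$ is $\bar T(a)=E[T]$. *)

theory Defs
  imports "HOL-Probability.Probability" "Jordan_Normal_Form.Matrix"
begin

text \<open>
  The argument \<open>x :: nat \<Rightarrow> real\<close> below is one realisation of the data: node \<open>i \<in> {1..n}\<close> holds \<open>x i\<close>.
\<close>

definition pos_nodes :: "nat \<Rightarrow> (nat \<Rightarrow> int) \<Rightarrow> nat set" where
  "pos_nodes n h = {i \<in> {1..n}. h i = 1}"

definition neg_nodes :: "nat \<Rightarrow> (nat \<Rightarrow> int) \<Rightarrow> nat set" where
  "neg_nodes n h = {i \<in> {1..n}. h i = -1}"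

text \<open>Rounds are numbered from 1; the values of \<open>shifted\<close> and \<open>digit\<close> at round 0 are never used.\<close>

fun shifted :: "real \<Rightarrow> nat \<Rightarrow> real" where
  "shifted u 0 = u"
| "shifted u (Suc 0) = u"
| "shifted u (Suc (Suc j)) =
     2 * shifted u (Suc j) - of_int \<lfloor>2 * shifted u (Suc j)\<rfloor>"

definition digit :: "real \<Rightarrow> nat \<Rightarrow> int" where
  "digit u j = \<lfloor>2 * shifted u j\<rfloor>"

definition bit_sum :: "nat \<Rightarrow> (nat \<Rightarrow> int) \<Rightarrow> (nat \<Rightarrow> real) \<Rightarrow> nat \<Rightarrow> int" where
  "bit_sum n h x l =
     (\<Sum>i\<in>pos_nodes n h. digit (x i) l) - (\<Sum>i\<in>neg_nodes n h. digit (x i) l)"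

definition partial_value :: "nat \<Rightarrow> (nat \<Rightarrow> int) \<Rightarrow> (nat \<Rightarrow> real) \<Rightarrow> nat \<Rightarrow> real" where
  "partial_value n h x j = (\<Sum>l=1..j. of_int (bit_sum n h x l) / 2 ^ l)"

definition lower_bound :: "nat \<Rightarrow> real \<Rightarrow> nat \<Rightarrow> real" where
  "lower_bound m a j = a - real m / 2 ^ j"

definition upper_bound :: "nat \<Rightarrow> nat \<Rightarrow> real \<Rightarrow> nat \<Rightarrow> real" where
  "upper_bound n m a j = a + (real n - real m) / 2 ^ j"

definition stops_at :: "nat \<Rightarrow> (nat \<Rightarrow> int) \<Rightarrow> real \<Rightarrow> (nat \<Rightarrow> real) \<Rightarrow> nat \<Rightarrow> bool" where
  "stops_at n h a x j \<longleftrightarrow>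
     partial_value n h x j \<le> lower_bound (card (pos_nodes n h)) a j \<or>
     partial_value n h x j \<ge> upper_bound n (card (pos_nodes n h)) a j"

text \<open>The infimum is \<open>\<infinity>\<close> on realisations for which the protocol never stops.\<close>

definition stop_round :: "nat \<Rightarrow> (nat \<Rightarrow> int) \<Rightarrow> real \<Rightarrow> (nat \<Rightarrow> real) \<Rightarrow> enat" where
  "stop_round n h a x = (INF j\<in>{j. 1 \<le> j \<and> stops_at n h a x j}. enat j)"

definition mean_stop_round ::
    "'a measure \<Rightarrow> (nat \<Rightarrow> 'a \<Rightarrow> real) \<Rightarrow> nat \<Rightarrow> (nat \<Rightarrow> int) \<Rightarrow> real \<Rightarrow> ennreal" where
  "mean_stop_round M X n h a =
     (\<integral>\<^sup>+ \<omega>. ennreal_of_enat (stop_round n h a (\<lambda>i. X i \<omega>)) \<partial>M)"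

text \<open>
  Matrix indices \<open>0, \<dots>, n - 2\<close> stand for the thresholds \<open>- (n - m) + 1, \<dots>, m - 1\<close>, in this order.
\<close>

definition threshold :: "nat \<Rightarrow> nat \<Rightarrow> nat \<Rightarrow> int" where
  "threshold n m k = - (int n - int m) + 1 + int k"

definition mean_vec ::
    "'a measure \<Rightarrow> (nat \<Rightarrow> 'a \<Rightarrow> real) \<Rightarrow> nat \<Rightarrow> (nat \<Rightarrow> int) \<Rightarrow> real Matrix.vec" where
  "mean_vec M X n h = Matrix.vec (n - 1)
     (\<lambda>k. enn2real (mean_stop_round M X n h
            (of_int (threshold n (card (pos_nodes n h)) k))))"

definition transition_mat ::
    "'a measure \<Rightarrow> (nat \<Rightarrow> 'a \<Rightarrow> real) \<Rightarrow> nat \<Rightarrow> (nat \<Rightarrow> int) \<Rightarrow> nat \<Rightarrow> real Matrix.mat" where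
  "transition_mat M X n h l = Matrix.mat (n - 1) (n - 1)
     (\<lambda>(r, c). measure M {\<omega> \<in> space M. bit_sum n h (\<lambda>i. X i \<omega>) l =
          2 * threshold n (card (pos_nodes n h)) r - threshold n (card (pos_nodes n h)) c})"

end

theory Submission imports Defs begin

text \<open>
  If \<open>u\<close> is uniform on the unit cube, then so is the vector obtained from \<open>u\<close> by inserting
  independent fair leading digits. Inserting digits with signed sum \<open>b\<close> turns round \<open>k + 1\<close>
  of the protocol with threshold \<open>a\<close> into round \<open>k\<close> with threshold \<open>2 a - b\<close>. Hence the
  probabilities of not having stopped by round \<open>k\<close> satisfy a first-step recursion with kernel \<open>Q\<close>, and
  summing it over \<open>k\<close> gives the linear system. The mean is finite because a bounded nonnegative
  potential drops on average by at least 1 in every round.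
\<close>

section \<open>Splitting leading digits off the uniform distribution\<close>

text \<open>The maps u/2 and (1 + u)/2 carry the uniform law on [0,1) to the uniform laws on its two
  halves, each of mass 1/2. In other words, the leading digit is fair and independent of the
  remaining digits.\<close>

lemma nn_integral_uniform_half:
  fixes f :: "real \<Rightarrow> ennreal"
  defines "U \<equiv> uniform_measure lborel {0..<1::real}"
  assumes [measurable]: "f \<in> borel_measurable borel"
  shows "(\<integral>\<^sup>+u. f u \<partial>U) = (1/2) * ((\<integral>\<^sup>+u. f (u / 2) \<partial>U) + (\<integral>\<^sup>+u. f ((1 + u) / 2) \<partial>U))"
proof -
  have U: "(\<integral>\<^sup>+u. g u \<partial>U) = (\<integral>\<^sup>+u. g u * indicator {0..<1} u \<partial>lborel)"
    if [measurable]: "g \<in> borel_measurable borel" for g :: "real \<Rightarrow> ennreal"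
    unfolding U_def by (subst nn_integral_uniform_measure) (auto simp: divide_ennreal_def)
  \<comment> \<open>The substitution v = (t + u)/2 maps [0,1) onto [t/2, (t+1)/2) and produces the
    factor 2; t = 0 and t = 1 give the two halves.\<close>
  have half: "(\<integral>\<^sup>+u. f ((t + u) / 2) * indicator {0..<1} u \<partial>lborel)
      = 2 * (\<integral>\<^sup>+u. f u * indicator {t/2..<(t+1)/2} u \<partial>lborel)" for t :: real
  proof -
    have "(\<integral>\<^sup>+u. f ((t + u) / 2) * indicator {0..<1} u \<partial>lborel) =
      ennreal \<bar>2\<bar> * (\<integral>\<^sup>+u. f ((t + (- t + 2 * u)) / 2) * indicator {0..<1} (- t + 2 * u) \<partial>lborel)"
      by (rule nn_integral_real_affine) auto
    also have "\<dots> = 2 * (\<integral>\<^sup>+u. f u * indicator {t/2..<(t+1)/2} u \<partial>lborel)"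
      by (auto intro!: arg_cong[where f = "\<lambda>x. 2 * x"] nn_integral_cong simp: indicator_def field_simps)
    finally show ?thesis .
  qed
  have "(\<integral>\<^sup>+u. f u \<partial>U) = (\<integral>\<^sup>+u. f u * indicator {0..<1/2} u + f u * indicator {1/2..<1} u \<partial>lborel)"
    by (subst U) (auto intro!: nn_integral_cong simp: indicator_def)
  also have "\<dots> = (\<integral>\<^sup>+u. f u * indicator {0..<1/2} u \<partial>lborel) + (\<integral>\<^sup>+u. f u * indicator {1/2..<1} u \<partial>lborel)"
    by (rule nn_integral_add) auto
  also have "\<dots> = (1/2) * (2 * (\<integral>\<^sup>+u. f u * indicator {0..<1/2} u \<partial>lborel) + 2 * (\<integral>\<^sup>+u. f u * indicator {1/2..<1} u \<partial>lborel))"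
  proof -
    have h: "(1/2) * (2 * c) = c" for c :: ennreal
      by (simp add: mult.assoc[symmetric] ennreal_divide_times)
    show ?thesis unfolding distrib_left h ..
  qed
  also have "\<dots> = (1/2) * ((\<integral>\<^sup>+u. f (u / 2) \<partial>U) + (\<integral>\<^sup>+u. f ((1 + u) / 2) \<partial>U))"
    using half[of 0] half[of 1] by (simp add: U)
  finally show ?thesis .
qed

text \<open>\<open>halve_with I D\<close> inserts a new leading binary digit at every node, namely 1 at the nodes of \<open>D\<close>
  and 0 elsewhere.\<close>

definition halve_with :: "'i set \<Rightarrow> 'i set \<Rightarrow> ('i \<Rightarrow> real) \<Rightarrow> 'i \<Rightarrow> real" where
  "halve_with I D u = (\<lambda>i\<in>I. (of_bool (i \<in> D) + u i) / 2)"

lemma halve_with_measurable [measurable]: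
  "halve_with I D \<in> measurable (PiM I (\<lambda>_. borel)) (PiM I (\<lambda>_. borel))"
  unfolding halve_with_def by measurable

abbreviation unit_cube_measure :: "'i set \<Rightarrow> ('i \<Rightarrow> real) measure" where
  "unit_cube_measure I \<equiv> PiM I (\<lambda>_. uniform_measure lborel {0..<1})"

lemma prob_space_uniform_unit: "prob_space (uniform_measure lborel {0..<1::real})"
  by (rule prob_space_uniform_measure) auto

lemma sets_unit_cube_measure [measurable_cong]:
  "sets (unit_cube_measure I) = sets (PiM I (\<lambda>_. borel))"
  by (intro sets_PiM_cong) auto

text \<open>Induction over the coordinates: Fubini isolates the new one,
  \<open>nn_integral_uniform_half\<close> splits it, and the induction hypothesis treats the others.
  The two halves correspond to the digit patterns without and with the new node.\<close>

lemma nn_integral_unit_cube_halve: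
  assumes "finite I" and "F \<in> borel_measurable (PiM I (\<lambda>_. borel))"
  shows "(\<integral>\<^sup>+u. F u \<partial>unit_cube_measure I) =
    (1/2) ^ card I * (\<Sum>D\<in>Pow I. \<integral>\<^sup>+u. F (halve_with I D u) \<partial>unit_cube_measure I)"
  using assms
proof (induction I arbitrary: F rule: finite_induct)
  case empty
  then show ?case
    by (simp add: PiM_empty nn_integral_count_space_finite halve_with_def restrict_def)
next
  case (insert i I)
  let ?U = "uniform_measure lborel {0..<1::real}"
  interpret product_sigma_finite "\<lambda>_. ?U"
    by (intro product_sigma_finite.intro prob_space_imp_sigma_finite prob_space_uniform_unit)
  interpret cube: prob_space "unit_cube_measure I"
    by (intro prob_space_PiM prob_space_uniform_unit)
  note [measurable] = insert.prems
  have cong: "F \<in> borel_measurable (unit_cube_measure (insert i I))"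
    by measurable
  have [measurable]: "(\<lambda>y. F (x(i := y))) \<in> borel_measurable borel"
    if "x \<in> space (PiM I (\<lambda>_. borel))" for x using that by measurable
  have [measurable]: "(\<lambda>x. F (x(i := y))) \<in> borel_measurable (PiM I (\<lambda>_. borel))" for y
    by measurable
  have upd: "halve_with (insert i I) D (x(i := y)) = (halve_with I D x)(i := (of_bool (i \<in> D) + y) / 2)"
    for D x y using insert.hyps by (auto simp: halve_with_def fun_eq_iff)
  have ins: "halve_with I (insert i D) = halve_with I D" for D
    using insert.hyps by (auto simp: halve_with_def fun_eq_iff)
  let ?G = "\<lambda>b D. (\<integral>\<^sup>+y. \<integral>\<^sup>+x. F ((halve_with I D x)(i := (b + y) / 2)) \<partial>unit_cube_measure I \<partial>?U)"
  have G: "(\<integral>\<^sup>+u. F (halve_with (insert i I) D u) \<partial>unit_cube_measure (insert i I)) = ?G (of_bool (i \<in> D)) D" for D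
    using insert.hyps
    by (subst product_nn_integral_insert_rev) (auto simp: upd)
  \<comment> \<open>The induction hypothesis is applied with coordinate \<open>i\<close> frozen at
    \<open>g y\<close>; both branches y/2 and (1 + y)/2 are instances.\<close>
  have step: "(\<integral>\<^sup>+y. \<integral>\<^sup>+x. F (x(i := g y)) \<partial>unit_cube_measure I \<partial>?U) =
    (1/2)^card I * (\<Sum>D\<in>Pow I. \<integral>\<^sup>+y. \<integral>\<^sup>+x. F ((halve_with I D x)(i := g y)) \<partial>unit_cube_measure I \<partial>?U)"
    if [measurable]: "g \<in> borel_measurable borel" for g :: "real \<Rightarrow> real"
  proof -
    have "(\<integral>\<^sup>+x. F (x(i := g y)) \<partial>unit_cube_measure I) =
      (1/2)^card I * (\<Sum>D\<in>Pow I. \<integral>\<^sup>+x. F ((halve_with I D x)(i := g y)) \<partial>unit_cube_measure I)" for y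
      by (rule insert.IH) measurable
    then show ?thesis
      by (simp add: nn_integral_cmult nn_integral_sum)
  qed
  have "(\<integral>\<^sup>+u. F u \<partial>unit_cube_measure (insert i I)) =
     (\<integral>\<^sup>+y. \<integral>\<^sup>+x. F (x(i := y)) \<partial>unit_cube_measure I \<partial>?U)"
    by (rule product_nn_integral_insert_rev[OF insert.hyps cong])
  also have "\<dots> = (1/2) * ((\<integral>\<^sup>+y. \<integral>\<^sup>+x. F (x(i := y/2)) \<partial>unit_cube_measure I \<partial>?U)
     + (\<integral>\<^sup>+y. \<integral>\<^sup>+x. F (x(i := (1+y)/2)) \<partial>unit_cube_measure I \<partial>?U))"
    by (rule nn_integral_uniform_half) measurable
  also have "(\<integral>\<^sup>+y. \<integral>\<^sup>+x. F (x(i := y/2)) \<partial>unit_cube_measure I \<partial>?U) = (1/2)^card I * (\<Sum>D\<in>Pow I. ?G 0 D)"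
    using step[of "\<lambda>y. y / 2"] by simp
  also have "(\<integral>\<^sup>+y. \<integral>\<^sup>+x. F (x(i := (1+y)/2)) \<partial>unit_cube_measure I \<partial>?U) = (1/2)^card I * (\<Sum>D\<in>Pow I. ?G 1 D)"
    by (rule step) measurable
  also have "(\<Sum>D\<in>Pow I. ?G 0 D) = (\<Sum>D\<in>Pow I. \<integral>\<^sup>+u. F (halve_with (insert i I) D u) \<partial>unit_cube_measure (insert i I))"
    using insert.hyps by (intro sum.cong refl) (subst G, auto)
  \<comment> \<open>Adding \<open>i\<close> to \<open>D\<close> leaves the digits inserted at the
    nodes of \<open>I\<close> unchanged.\<close>
  also have "(\<Sum>D\<in>Pow I. ?G 1 D) = (\<Sum>D\<in>insert i ` Pow I. \<integral>\<^sup>+u. F (halve_with (insert i I) D u) \<partial>unit_cube_measure (insert i I))"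
    using insert.hyps by (subst sum.reindex) (auto simp: G ins inj_on_def intro!: sum.cong)
  finally show ?case
    using insert.hyps
    apply (simp add: Pow_insert)
    apply (subst sum.union_disjoint)
    apply (auto simp: distrib_left mult.assoc)
    done
qed

text \<open>The product measure lives on functions with arbitrary real values, whereas the digit
  identities need values in [0,1); the difference is a null set.\<close>

lemma AE_unit_cube: 
  assumes "finite I"
  shows "AE u in unit_cube_measure I. \<forall>i\<in>I. 0 \<le> u i \<and> u i < 1"
proof -
  have "AE u in uniform_measure lborel {0..<1::real}. 0 \<le> u \<and> u < 1"
    by (rule AE_uniform_measureI) auto
  then show ?thesis using assms
    by (intro AE_finite_allI AE_PiM_component prob_space_uniform_unit)
qed

declare One_nat_def [simp del]

section \<open>The protocol after inserting a leading digit\<close>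

text \<open>Since u lies in [0,1), the floor of d + u is d, so the first shift removes exactly the
  inserted digit. From then on both sequences follow the same recursion.\<close>

lemma shifted_half:
  assumes "0 \<le> u" "u < 1"
  shows "shifted ((of_bool d + u) / 2) (Suc (Suc j)) = shifted u (Suc j)"
proof (induction j)
  case 0
  have "\<lfloor>of_bool d + u\<rfloor> = of_bool d"
    using assms by (cases d) (auto simp: floor_eq_iff)
  moreover have "2 * ((of_bool d + u) / 2) = of_bool d + u"
    by simp
  ultimately show ?case by (simp only: shifted.simps) simp
qed simp

lemma digit_half:
  assumes "0 \<le> u" "u < 1"
  shows "digit ((of_bool d + u) / 2) (Suc 0) = of_bool d"
    and "digit ((of_bool d + u) / 2) (Suc (Suc j)) = digit u (Suc j)"
  using assms shifted_half[OF assms, of d j] by (cases d; auto simp: digit_def floor_eq_iff)+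

text \<open>This is B(1) when exactly the nodes of \<open>D\<close> have leading digit 1.\<close>

definition first_bit_sum :: "nat \<Rightarrow> (nat \<Rightarrow> int) \<Rightarrow> nat set \<Rightarrow> int" where
  "first_bit_sum n h D = int (card (D \<inter> pos_nodes n h)) - int (card (D \<inter> neg_nodes n h))"

lemma pos_nodes_subset: "pos_nodes n h \<subseteq> {1..n}" and neg_nodes_subset: "neg_nodes n h \<subseteq> {1..n}"
  by (auto simp: pos_nodes_def neg_nodes_def)

lemma finite_nodes [simp]: "finite (pos_nodes n h)" "finite (neg_nodes n h)"
  by (auto simp: pos_nodes_def neg_nodes_def)

lemma bit_sum_halve:
  assumes "\<forall>i\<in>{1..n}. 0 \<le> u i \<and> u i < 1"
  shows "bit_sum n h (halve_with {1..n} D u) (Suc 0) = first_bit_sum n h D"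
    and "bit_sum n h (halve_with {1..n} D u) (Suc (Suc l)) = bit_sum n h u (Suc l)"
proof -
  have *: "digit (halve_with {1..n} D u i) (Suc 0) = of_bool (i \<in> D)"
       "digit (halve_with {1..n} D u i) (Suc (Suc l)) = digit (u i) (Suc l)"
    if "i \<in> {1..n}" for i
    using that assms digit_half[of "u i" "i \<in> D"] by (auto simp: halve_with_def)
  have pos: "digit (halve_with {1..n} D u i) (Suc 0) = of_bool (i \<in> D)"
       "digit (halve_with {1..n} D u i) (Suc (Suc l)) = digit (u i) (Suc l)"
     if "i \<in> pos_nodes n h \<or> i \<in> neg_nodes n h" for i
    by (rule *; use that pos_nodes_subset neg_nodes_subset in blast)+
  show "bit_sum n h (halve_with {1..n} D u) (Suc 0) = first_bit_sum n h D"
    by (simp add: bit_sum_def first_bit_sum_def pos Int_commute flip: sum.inter_restrict)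
  show "bit_sum n h (halve_with {1..n} D u) (Suc (Suc l)) = bit_sum n h u (Suc l)"
    by (simp add: bit_sum_def pos)
qed

text \<open>The inserted digits contribute half of their signed sum, and every old digit moves one
  place to the right, which halves its weight.\<close>

lemma partial_value_halve:
  assumes "\<forall>i\<in>{1..n}. 0 \<le> u i \<and> u i < 1"
  shows "partial_value n h (halve_with {1..n} D u) (Suc k) =
    (of_int (first_bit_sum n h D) + partial_value n h u k) / 2"
proof -
  have "partial_value n h (halve_with {1..n} D u) (Suc k) =
     of_int (first_bit_sum n h D) / 2 +
     (\<Sum>l=1..k. of_int (bit_sum n h (halve_with {1..n} D u) (Suc l)) / 2 ^ Suc l)"
    unfolding partial_value_def
    by (subst sum.atLeast_Suc_atMost)
       (simp_all add: bit_sum_halve[OF assms, unfolded One_nat_def] sum.shift_bounds_cl_Suc_ivl One_nat_def del: power_Suc sum.cl_ivl_Suc)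
  also have "(\<Sum>l=1..k. of_int (bit_sum n h (halve_with {1..n} D u) (Suc l)) / 2 ^ Suc l) =
     (\<Sum>l=1..k. of_int (bit_sum n h u l) / 2 ^ Suc l :: real)"
  proof (intro sum.cong refl)
    fix l assume "l \<in> {1..k}"
    then obtain l' where "l = Suc l'" by (cases l) auto
    then show "real_of_int (bit_sum n h (halve_with {1..n} D u) (Suc l)) / 2 ^ Suc l =
        real_of_int (bit_sum n h u l) / 2 ^ Suc l"
      by (simp add: bit_sum_halve[OF assms])
  qed
  finally show ?thesis
    by (simp add: partial_value_def add_divide_distrib sum_divide_distrib mult.commute)
qed

text \<open>Doubling both stopping inequalities turns m/2^(k+1) into m/2^k, likewise for n - m, and
  moves the inserted sum b to the threshold side, giving 2a - b. This self-similarity is the source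
  of the index 2a - a' in the matrix.\<close>

lemma stops_at_halve:
  assumes "\<forall>i\<in>{1..n}. 0 \<le> u i \<and> u i < 1"
  shows "stops_at n h a (halve_with {1..n} D u) (Suc k) \<longleftrightarrow>
    stops_at n h (2 * a - of_int (first_bit_sum n h D)) u k"
proof -
  define c :: real where "c = 2 ^ k"
  have "0 < c" by (simp add: c_def)
  then show ?thesis
    unfolding stops_at_def partial_value_halve[OF assms] lower_bound_def upper_bound_def
      power_Suc c_def[symmetric]
    by (auto simp: divide_simps) (auto simp: algebra_simps)
qed

text \<open>At round 0, before any exchange, the stopping rule still makes sense and says that the
  threshold lies outside the interval of possible sums. This makes \<open>stops_at_halve\<close> hold
  from \<open>k = 0\<close> on, and lets one recursion cover both the first and the later rounds.\<close>

definition undecided :: "nat \<Rightarrow> (nat \<Rightarrow> int) \<Rightarrow> real \<Rightarrow> bool" where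
  "undecided n h a \<longleftrightarrow> real (card (pos_nodes n h)) - real n < a \<and> a < real (card (pos_nodes n h))"

lemma stops_at_0: "stops_at n h a u 0 \<longleftrightarrow> \<not> undecided n h a"
  by (auto simp: stops_at_def undecided_def partial_value_def lower_bound_def upper_bound_def)

section \<open>Restriction to the nodes and measurability\<close>

lemma bit_sum_restrict: "bit_sum n h (restrict x {1..n}) l = bit_sum n h x l"
  unfolding bit_sum_def
  by (intro arg_cong2[where f = minus] sum.cong refl; simp add: pos_nodes_def neg_nodes_def)

lemma stops_at_restrict: "stops_at n h a (restrict x {1..n}) k \<longleftrightarrow> stops_at n h a x k"
  by (simp add: stops_at_def partial_value_def bit_sum_restrict)

lemma shifted_measurable [measurable]: "(\<lambda>u. shifted u j) \<in> borel_measurable borel"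
proof (induction j rule: induct_nat_012)
  case (ge2 j)
  note [measurable] = ge2.IH
  show ?case by simp
qed auto

lemma digit_measurable [measurable]: "(\<lambda>u. digit u j) \<in> measurable borel (count_space UNIV)"
  unfolding digit_def by measurable

lemma bit_sum_measurable [measurable]:
  "(\<lambda>u. bit_sum n h u l) \<in> measurable (PiM {1..n} (\<lambda>_. borel)) (count_space UNIV)"
proof -
  have [measurable]: "(\<lambda>u. digit (u i) l) \<in> measurable (PiM {1..n} (\<lambda>_. borel)) (count_space UNIV)"
    if "i \<in> pos_nodes n h \<or> i \<in> neg_nodes n h" for i
    using that pos_nodes_subset[of n h] neg_nodes_subset[of n h] 
    by (intro measurable_compose[OF _ digit_measurable] measurable_component_singleton) auto
  \<comment> \<open>Measurability of sums is obtained over the reals and brought back to the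
    integers by the floor function.\<close>
  have "(\<lambda>u. real_of_int (bit_sum n h u l)) \<in> borel_measurable (PiM {1..n} (\<lambda>_. borel))"
    unfolding bit_sum_def of_int_diff of_int_sum by measurable
  then have "(\<lambda>u. \<lfloor>real_of_int (bit_sum n h u l)\<rfloor>) \<in> measurable (PiM {1..n} (\<lambda>_. borel)) (count_space UNIV)"
    by measurable
  then show ?thesis by simp
qed

lemma stops_at_measurable [measurable]:
  "Measurable.pred (PiM {1..n} (\<lambda>_. borel)) (\<lambda>u. stops_at n h a u k)"
  unfolding stops_at_def partial_value_def by measurable

section \<open>First-step recursion for survival probabilities\<close>

text \<open>Version of \<open>nn_integral_unit_cube_halve\<close> for events. The equivalence of
  \<open>P\<close> and \<open>Q\<close> is required on the unit cube only, which suffices by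
  \<open>AE_unit_cube\<close>.\<close>

lemma measure_unit_cube_halve:
  assumes "finite I" and [measurable]: "Measurable.pred (PiM I (\<lambda>_. borel)) P"
    and PQ: "\<And>D u. \<forall>i\<in>I. 0 \<le> u i \<and> u i < 1 \<Longrightarrow> P (halve_with I D u) \<longleftrightarrow> Q D u"
    and [measurable]: "\<And>D. Measurable.pred (PiM I (\<lambda>_. borel)) (Q D)"
  shows "measure (unit_cube_measure I) {u \<in> space (unit_cube_measure I). P u} =
    (1/2) ^ card I * (\<Sum>D\<in>Pow I. measure (unit_cube_measure I) {u \<in> space (unit_cube_measure I). Q D u})"
proof -
  let ?C = "unit_cube_measure I"
  interpret prob_space ?C
    by (intro prob_space_PiM prob_space_uniform_unit)
  have int: "emeasure ?C {u \<in> space ?C. R u} = (\<integral>\<^sup>+u. of_bool (R u) \<partial>?C)"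
    if [measurable]: "Measurable.pred (PiM I (\<lambda>_. borel)) R" for R
  proof -
    have "(\<integral>\<^sup>+u. of_bool (R u) \<partial>?C) = (\<integral>\<^sup>+u. indicator {u \<in> space ?C. R u} u \<partial>?C)"
      by (intro nn_integral_cong) (auto simp: indicator_def)
    also have "\<dots> = emeasure ?C {u \<in> space ?C. R u}"
      by (rule nn_integral_indicator) measurable
    finally show ?thesis ..
  qed
  have "emeasure ?C {u \<in> space ?C. P u} =
    (1/2) ^ card I * (\<Sum>D\<in>Pow I. \<integral>\<^sup>+u. of_bool (P (halve_with I D u)) \<partial>?C)"
    unfolding int[OF assms(2)] using assms(1) by (rule nn_integral_unit_cube_halve) measurable
  also have "(\<lambda>D. \<integral>\<^sup>+u. of_bool (P (halve_with I D u)) \<partial>?C) = (\<lambda>D. \<integral>\<^sup>+u. of_bool (Q D u) \<partial>?C)"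
    by (intro ext nn_integral_cong_AE eventually_mono[OF AE_unit_cube[OF assms(1)]]) (simp add: PQ)
  also have "\<dots> = (\<lambda>D. ennreal (measure ?C {u \<in> space ?C. Q D u}))"
    by (simp add: int flip: emeasure_eq_measure)
  finally have "ennreal (measure ?C {u \<in> space ?C. P u}) =
     (1/2) ^ card I * ennreal (\<Sum>D\<in>Pow I. measure ?C {u \<in> space ?C. Q D u})"
    by (simp add: emeasure_eq_measure sum_ennreal)
  also have "(1/2) ^ card I = ennreal ((1/2) ^ card I)"
    by (simp add: divide_ennreal flip: ennreal_power ennreal_1 ennreal_numeral)
  finally show ?thesis
    by (simp add: sum_nonneg flip: ennreal_mult)
qed

text \<open>For an undecided threshold this is Pr[T > k]. Including round 0 makes it vanish for all
  other thresholds, which supplies the boundary values of the recursion.\<close>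

definition survival :: "nat \<Rightarrow> (nat \<Rightarrow> int) \<Rightarrow> real \<Rightarrow> nat \<Rightarrow> real" where
  "survival n h a k = measure (unit_cube_measure {1..n})
     {u \<in> space (unit_cube_measure {1..n}). \<forall>j\<le>k. \<not> stops_at n h a u j}"

lemma survival_nonneg: "0 \<le> survival n h a k"
  by (simp add: survival_def)

lemma survival_eq_0: "\<not> undecided n h a \<Longrightarrow> survival n h a k = 0"
proof -
  assume "\<not> undecided n h a"
  then have "{u \<in> space (unit_cube_measure {1..n}). \<forall>j\<le>k. \<not> stops_at n h a u j} = {}"
    by (auto simp: stops_at_0 intro!: exI[of _ 0])
  then show ?thesis by (simp only: survival_def measure_empty)
qed

lemma survival_0:
  assumes "undecided n h a"
  shows "survival n h a 0 = 1"
proof -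
  interpret prob_space "unit_cube_measure {1..n}"
    by (intro prob_space_PiM prob_space_uniform_unit)
  show ?thesis using assms by (simp add: survival_def stops_at_0 prob_space)
qed

text \<open>An undecided threshold does not stop at round 0, so only rounds 1 to k + 1 matter.
  Conditioning on the leading digits turns them into rounds 0 to k for the new threshold.\<close>

lemma survival_Suc:
  assumes "undecided n h a"
  shows "survival n h a (Suc k) =
    (1/2) ^ n * (\<Sum>D\<in>Pow {1..n}. survival n h (2 * a - of_int (first_bit_sum n h D)) k)"
proof -
  have "(\<forall>j\<le>Suc k. \<not> stops_at n h a u j) \<longleftrightarrow> (\<forall>j\<le>k. \<not> stops_at n h a u (Suc j))" for u
    using assms by (metis stops_at_0 not0_implies_Suc Suc_le_mono)
  then have "survival n h a (Suc k) = measure (unit_cube_measure {1..n})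
     {u \<in> space (unit_cube_measure {1..n}). \<forall>j\<le>k. \<not> stops_at n h a u (Suc j)}"
    by (simp add: survival_def)
  also have "\<dots> = (1/2) ^ card {1..n} *
    (\<Sum>D\<in>Pow {1..n}. survival n h (2 * a - of_int (first_bit_sum n h D)) k)"
    unfolding survival_def
    by (rule measure_unit_cube_halve) (auto simp: stops_at_halve)
  finally show ?thesis by simp
qed

text \<open>Counting form of Pr[B(l) = c]: all 2^n digit patterns of a round are equally
  likely.\<close>

definition bit_sum_prob :: "nat \<Rightarrow> (nat \<Rightarrow> int) \<Rightarrow> int \<Rightarrow> real" where
  "bit_sum_prob n h c = (1/2) ^ n * real (card {D \<in> Pow {1..n}. first_bit_sum n h D = c})"

text \<open>In the first round the inserted pattern determines the sum. In a later round, inserting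
  a digit only shifts the round number, so the average consists of 2^n equal terms and the
  probability does not depend on the round.\<close>

lemma measure_bit_sum:
  "measure (unit_cube_measure {1..n}) {u \<in> space (unit_cube_measure {1..n}). bit_sum n h u (Suc l) = c}
    = bit_sum_prob n h c"
proof (induction l)
  let ?C = "unit_cube_measure {1..n}"
  interpret prob_space ?C
    by (intro prob_space_PiM prob_space_uniform_unit)
  {
    case 0
    have "measure ?C {u \<in> space ?C. bit_sum n h u (Suc 0) = c} =
      (1/2) ^ card {1..n} * (\<Sum>D\<in>Pow {1..n}. measure ?C {u \<in> space ?C. first_bit_sum n h D = c})"
      by (rule measure_unit_cube_halve) (auto simp: bit_sum_halve)
    also have "(\<lambda>D. measure ?C {u \<in> space ?C. first_bit_sum n h D = c}) =
        (\<lambda>D. of_bool (first_bit_sum n h D = c))"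
      by (auto simp: prob_space)
    finally show ?case
      by (simp add: bit_sum_prob_def Int_def)
  next
    case (Suc l)
    have "measure ?C {u \<in> space ?C. bit_sum n h u (Suc (Suc l)) = c} =
      (1/2) ^ card {1..n} * (\<Sum>D\<in>Pow {1..n}. measure ?C {u \<in> space ?C. bit_sum n h u (Suc l) = c})"
      by (rule measure_unit_cube_halve) (auto simp: bit_sum_halve)
    then show ?case
      by (simp add: Suc card_Pow power_one_over)
  }
qed

section \<open>Finiteness of the mean by a drift argument\<close>

lemma card_pos_neg_nodes:
  assumes "\<forall>i\<in>{1..n}. h i \<in> {-1, 1}"
  shows "card (pos_nodes n h) + card (neg_nodes n h) = n"
proof -
  have "pos_nodes n h \<union> neg_nodes n h = {1..n}" "pos_nodes n h \<inter> neg_nodes n h = {}"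
    using assms by (auto simp: pos_nodes_def neg_nodes_def)
  then show ?thesis
    using card_Un_disjoint[OF finite_nodes(1)[of n h] finite_nodes(2)[of n h]] by simp
qed

text \<open>If a is nonnegative, let exactly the negative nodes send 1; otherwise let exactly the
  positive nodes do so. Being strictly inside the interval gives the gain of at least 1 in absolute
  value.\<close>

lemma exists_outward_step:
  assumes "\<forall>i\<in>{1..n}. h i \<in> {-1, 1}" and "undecided n h (of_int a)"
  shows "\<exists>D\<in>Pow {1..n}. \<bar>a\<bar> + 1 \<le> \<bar>2 * a - first_bit_sum n h D\<bar>"
proof -
  let ?P = "pos_nodes n h" and ?N = "neg_nodes n h"
  have disj: "?N \<inter> ?P = {}" "?P \<inter> ?N = {}"
    by (auto simp: pos_nodes_def neg_nodes_def)
  have a: "- int (card ?N) < a" "a < int (card ?P)"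
    using assms(2) card_pos_neg_nodes[OF assms(1)] unfolding undecided_def by linarith+
  have "first_bit_sum n h ?N = - int (card ?N)" "first_bit_sum n h ?P = int (card ?P)"
    by (simp_all add: first_bit_sum_def disj)
  then have "\<bar>a\<bar> + 1 \<le> \<bar>2 * a - first_bit_sum n h (if 0 \<le> a then ?N else ?P)\<bar>"
    using a by auto
  moreover have "(if 0 \<le> a then ?N else ?P) \<in> Pow {1..n}"
    using pos_nodes_subset neg_nodes_subset by simp
  ultimately show ?thesis by blast
qed

text \<open>An undecided threshold moves away from 0 with probability at least \<open>2 ^ -n\<close>. The base
  \<open>2 ^ (n + 1)\<close> is large enough for this one event to lower the mean of the potential by at least 1.\<close>

definition potential :: "nat \<Rightarrow> (nat \<Rightarrow> int) \<Rightarrow> int \<Rightarrow> real" where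
  "potential n h a = (if undecided n h (of_int a) then (2 ^ Suc n) ^ n - (2 ^ Suc n) ^ nat \<bar>a\<bar> else 0)"

lemma undecided_abs_less:
  assumes "undecided n h (of_int a)"
  shows "nat \<bar>a\<bar> < n"
proof -
  have "card (pos_nodes n h) \<le> n"
    using card_mono[OF _ pos_nodes_subset[of n h]] by simp
  then show ?thesis using assms unfolding undecided_def by linarith
qed

lemma potential_le: "potential n h a \<le> (2 ^ Suc n) ^ n"
  by (simp add: potential_def)

text \<open>With K = 2^(n+1), the outward pattern contributes at most K^n - K^(\<bar>a\<bar>+1) and
  each of the other 2^n - 1 patterns at most K^n. Because K/2^n = 2, the average is at most K^n - 2
  K^\<bar>a\<bar>, which lies K^\<bar>a\<bar> \<ge> 1 below the potential of a.\<close>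

lemma potential_drift:
  assumes "\<forall>i\<in>{1..n}. h i \<in> {-1, 1}" and a: "undecided n h (of_int a)"
  shows "1 + (1/2) ^ n * (\<Sum>D\<in>Pow {1..n}. potential n h (2 * a - first_bit_sum n h D)) \<le> potential n h a"
proof -
  define K :: real where "K = 2 ^ Suc n"
  have K: "1 \<le> K" unfolding K_def by (rule one_le_power) simp
  let ?v = "\<lambda>D. potential n h (2 * a - first_bit_sum n h D)"
  obtain D where D: "D \<in> Pow {1..n}" "\<bar>a\<bar> + 1 \<le> \<bar>2 * a - first_bit_sum n h D\<bar>"
    using exists_outward_step[OF assms] by blast
  have "?v D \<le> K ^ n - K ^ Suc (nat \<bar>a\<bar>)"
  proof (cases "undecided n h (of_int (2 * a - first_bit_sum n h D))")
    case True
    have "K ^ Suc (nat \<bar>a\<bar>) \<le> K ^ nat \<bar>2 * a - first_bit_sum n h D\<bar>"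
      using D(2) by (intro power_increasing K) linarith
    then show ?thesis using True by (simp add: potential_def K_def)
  next
    \<comment> \<open>Here the new potential is 0, so the bound only needs its right side to be
      nonnegative, which follows from \<bar>a\<bar> < n.\<close>
    case False
    have "K ^ Suc (nat \<bar>a\<bar>) \<le> K ^ n"
      using undecided_abs_less[OF a] by (intro power_increasing K) simp
    then show ?thesis using False by (simp add: potential_def)
  qed
  moreover have "(\<Sum>D\<in>Pow {1..n} - {D}. ?v D) \<le> (\<Sum>D\<in>Pow {1..n} - {D}. K ^ n)"
    by (intro sum_mono) (simp only: potential_le K_def)
  moreover have "(\<Sum>D\<in>Pow {1..n} - {D}. K ^ n) = (2 ^ n - 1) * K ^ n"
    using D(1) by (simp add: card_Diff_singleton card_Pow of_nat_diff)
  ultimately have "(\<Sum>D\<in>Pow {1..n}. ?v D) \<le> 2 ^ n * K ^ n - K * K ^ nat \<bar>a\<bar>"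
    using D(1) by (subst sum.remove[of _ D]) (auto simp: algebra_simps)
  then have "(1/2) ^ n * (\<Sum>D\<in>Pow {1..n}. ?v D) \<le> (1/2) ^ n * (2 ^ n * K ^ n - K * K ^ nat \<bar>a\<bar>)"
    by (intro mult_left_mono) auto
  also have "\<dots> = K ^ n - 2 * K ^ nat \<bar>a\<bar>"
    by (simp add: K_def power_one_over field_simps)
  finally show ?thesis
    using a one_le_power[OF K, of "nat \<bar>a\<bar>"] by (simp add: potential_def K_def)
qed

text \<open>Induction on \<open>N\<close> for all thresholds at once: the recursion writes a sum of
  N + 1 terms as 1 plus an average of sums of N terms at the new thresholds, and the drift
  inequality absorbs the 1.\<close>

lemma survival_partial_sum_le:
  assumes "\<forall>i\<in>{1..n}. h i \<in> {-1, 1}"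
  shows "(\<Sum>k<N. survival n h (of_int a) k) \<le> potential n h a"
proof (induction N arbitrary: a)
  case 0
  have "(2 ^ Suc n) ^ nat \<bar>a\<bar> \<le> ((2 ^ Suc n) ^ n :: real)" if "undecided n h (of_int a)"
    using undecided_abs_less[OF that] by (intro power_increasing one_le_power) auto
  then show ?case by (simp add: potential_def)
next
  case (Suc N)
  show ?case
  proof (cases "undecided n h (of_int a)")
    case True
    let ?next = "\<lambda>D. 2 * a - first_bit_sum n h D"
    have "(\<Sum>k<Suc N. survival n h (of_int a) k) =
       1 + (\<Sum>k<N. (1/2) ^ n * (\<Sum>D\<in>Pow {1..n}. survival n h (of_int (?next D)) k))"
      unfolding sum.lessThan_Suc_shift using True by (simp add: survival_0 survival_Suc)
    also have "\<dots> = 1 + (1/2) ^ n * (\<Sum>D\<in>Pow {1..n}. \<Sum>k<N. survival n h (of_int (?next D)) k)"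
      by (subst sum.swap) (simp add: sum_distrib_left)
    also have "\<dots> \<le> 1 + (1/2) ^ n * (\<Sum>D\<in>Pow {1..n}. potential n h (?next D))"
      by (intro add_left_mono mult_left_mono sum_mono Suc.IH) auto
    also have "\<dots> \<le> potential n h a"
      by (rule potential_drift[OF assms True])
    finally show ?thesis .
  next
    case False
    then show ?thesis by (simp add: survival_eq_0 potential_def)
  qed
qed

lemma survival_summable:
  assumes "\<forall>i\<in>{1..n}. h i \<in> {-1, 1}"
  shows "summable (survival n h (of_int a))"
  by (rule summableI_nonneg_bounded[OF survival_nonneg survival_partial_sum_le[OF assms]])

section \<open>First-step equations and their matrix form\<close>

text \<open>Tail-sum formula for E[T] at undecided thresholds, with value 0 at all others.\<close>

definition expected_rounds :: "nat \<Rightarrow> (nat \<Rightarrow> int) \<Rightarrow> int \<Rightarrow> real" where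
  "expected_rounds n h a = (\<Sum>k. survival n h (of_int a) k)"

lemma expected_rounds_eq_0: "\<not> undecided n h (of_int a) \<Longrightarrow> expected_rounds n h a = 0"
  by (simp add: expected_rounds_def survival_eq_0)

text \<open>Sum \<open>survival_Suc\<close> over all rounds: the term at k = 0 is the 1, and
  summability permits exchanging the series with the finite average.\<close>

lemma expected_rounds_first_step:
  assumes h: "\<forall>i\<in>{1..n}. h i \<in> {-1, 1}" and "undecided n h (of_int a)"
  shows "expected_rounds n h a =
    1 + (1/2) ^ n * (\<Sum>D\<in>Pow {1..n}. expected_rounds n h (2 * a - first_bit_sum n h D))"
proof -
  let ?next = "\<lambda>D. 2 * a - first_bit_sum n h D"
  have "expected_rounds n h a = 1 + (\<Sum>k. survival n h (of_int a) (Suc k))"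
    using suminf_split_head[OF survival_summable[OF h, of a]] assms(2)
    by (simp add: expected_rounds_def survival_0)
  also have "(\<lambda>k. survival n h (of_int a) (Suc k)) =
     (\<lambda>k. (1/2) ^ n * (\<Sum>D\<in>Pow {1..n}. survival n h (of_int (?next D)) k))"
    using survival_Suc[OF assms(2)] by simp
  also have "(\<Sum>k. (1/2) ^ n * (\<Sum>D\<in>Pow {1..n}. survival n h (of_int (?next D)) k)) =
     (1/2) ^ n * (\<Sum>D\<in>Pow {1..n}. expected_rounds n h (?next D))"
    unfolding expected_rounds_def using survival_summable[OF h]
    by (subst suminf_mult) (auto intro!: summable_sum suminf_sum simp del: of_int_diff)
  finally show ?thesis .
qed

lemma undecided_iff_threshold:
  assumes "card (pos_nodes n h) = m"
  shows "undecided n h (of_int a) \<longleftrightarrow> (\<exists>k<n - 1. a = threshold n m k)"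
proof
  assume a: "undecided n h (of_int a)"
  then have "int m - int n < a" "a < int m"
    using assms unfolding undecided_def by linarith+
  then show "\<exists>k<n - 1. a = threshold n m k"
    by (intro exI[of _ "nat (a + int n - int m - 1)"]) (auto simp: threshold_def)
next
  assume "\<exists>k<n - 1. a = threshold n m k"
  then have "int m - int n < a" "a < int m"
    by (auto simp: threshold_def)
  then show "undecided n h (of_int a)"
    using assms unfolding undecided_def by linarith
qed

text \<open>Grouping the patterns by the new threshold a' = 2a - b, that is b = 2a - a', turns the
  average into row a of \<open>Q\<close> applied to \<open>f\<close>. Since \<open>f\<close>
  vanishes at decided thresholds, the n - 1 matrix indices suffice.\<close>

lemma average_over_first_bits:
  assumes m: "card (pos_nodes n h) = m"
    and f: "\<And>b. \<not> undecided n h (of_int b) \<Longrightarrow> f b = (0::real)"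
  shows "(1/2) ^ n * (\<Sum>D\<in>Pow {1..n}. f (2 * a - first_bit_sum n h D)) =
    (\<Sum>k<n-1. bit_sum_prob n h (2 * a - threshold n m k) * f (threshold n m k))"
proof -
  have inj: "threshold n m j = threshold n m k \<longleftrightarrow> j = k" for j k
    by (simp add: threshold_def)
  have "f b = (\<Sum>k<n-1. of_bool (b = threshold n m k) * f (threshold n m k))" for b
  proof (cases "undecided n h (of_int b)")
    case True
    then obtain j where "j < n - 1" "b = threshold n m j"
      using undecided_iff_threshold[OF m] by blast
    then show ?thesis by (simp add: inj if_distrib[of "\<lambda>x. x * _"] of_bool_def cong: if_cong)
  next
    case False
    then show ?thesis using undecided_iff_threshold[OF m] by (auto simp: f)
  qed
  then have "(\<Sum>D\<in>Pow {1..n}. f (2 * a - first_bit_sum n h D)) = (\<Sum>D\<in>Pow {1..n}. \<Sum>k<n-1.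
       of_bool (2 * a - first_bit_sum n h D = threshold n m k) * f (threshold n m k))"
    by (intro sum.cong refl)
  also have "\<dots> = (\<Sum>k<n-1. real (card {D\<in>Pow {1..n}. first_bit_sum n h D = 2 * a - threshold n m k})
      * f (threshold n m k))"
  proof (subst sum.swap, intro sum.cong refl)
    fix k
    have "(\<Sum>D\<in>Pow {1..n}. of_bool (2 * a - first_bit_sum n h D = threshold n m k) * f (threshold n m k)) =
      (\<Sum>D\<in>{D\<in>Pow {1..n}. first_bit_sum n h D = 2 * a - threshold n m k}. f (threshold n m k))"
      by (subst sum.inter_filter) (auto intro!: sum.cong simp: of_bool_def)
    then show "(\<Sum>D\<in>Pow {1..n}. of_bool (2 * a - first_bit_sum n h D = threshold n m k) * f (threshold n m k)) =
      real (card {D\<in>Pow {1..n}. first_bit_sum n h D = 2 * a - threshold n m k}) * f (threshold n m k)"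
      by simp
  qed
  finally show ?thesis
    by (simp add: bit_sum_prob_def sum_distrib_left mult.assoc)
qed

section \<open>Transfer to the given probability space\<close>

context prob_space
begin

text \<open>By independence the joint law of the data is the uniform law on the cube. Joint samples
  are restricted to \<open>I\<close>, so \<open>P\<close> must depend on those coordinates
  only.\<close>

lemma measure_iid_uniform:
  assumes "I \<noteq> {}" and X: "indep_vars (\<lambda>_. borel) X I"
    and U: "\<And>i. i \<in> I \<Longrightarrow> distr M borel (X i) = uniform_measure lborel {0..<1}"
    and [measurable]: "Measurable.pred (PiM I (\<lambda>_. borel)) P"
    and P: "\<And>x. P (restrict x I) \<longleftrightarrow> P x"
  shows "measure M {\<omega> \<in> space M. P (\<lambda>i. X i \<omega>)} =
    measure (unit_cube_measure I) {u \<in> space (unit_cube_measure I). P u}"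
proof -
  have [measurable]: "X i \<in> borel_measurable M" if "i \<in> I" for i
    using X that by (simp add: indep_vars_def)
  have "distr M (PiM I (\<lambda>_. borel)) (\<lambda>\<omega>. \<lambda>i\<in>I. X i \<omega>) = PiM I (\<lambda>i. distr M borel (X i))"
    using X by (subst (asm) indep_vars_iff_distr_eq_PiM') (use assms(1) in auto)
  also have "\<dots> = unit_cube_measure I"
    by (intro PiM_cong refl U)
  finally have *: "unit_cube_measure I = distr M (PiM I (\<lambda>_. borel)) (\<lambda>\<omega>. \<lambda>i\<in>I. X i \<omega>)" ..
  have "measure (unit_cube_measure I) {u \<in> space (PiM I (\<lambda>_. borel)). P u} =
    measure M ((\<lambda>\<omega>. \<lambda>i\<in>I. X i \<omega>) -` {u \<in> space (PiM I (\<lambda>_. borel)). P u} \<inter> space M)"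
    unfolding * by (rule measure_distr) measurable
  also have "(\<lambda>\<omega>. \<lambda>i\<in>I. X i \<omega>) -` {u \<in> space (PiM I (\<lambda>_. borel)). P u} \<inter> space M =
      {\<omega> \<in> space M. P (\<lambda>i. X i \<omega>)}"
    by (auto simp: space_PiM P)
  finally show ?thesis
    by (simp add: space_PiM)
qed

text \<open>The mean of a variable with values in \<open>enat\<close> is the sum of its tail
  probabilities, and T > k means that no stop occurs up to round k.\<close>

lemma mean_stop_round_eq:
  assumes "1 \<le> n" and h: "\<forall>i\<in>{1..n}. h i \<in> {-1, 1}"
    and X: "indep_vars (\<lambda>_. borel) X {1..n}"
    and U: "\<And>i. i \<in> {1..n} \<Longrightarrow> distr M borel (X i) = uniform_measure lborel {0..<1}"
    and a: "undecided n h (of_int a)"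
  shows "mean_stop_round M X n h (of_int a) = ennreal (expected_rounds n h a)"
proof -
  have Xm [measurable]: "X i \<in> borel_measurable M" if "i \<in> {1..n}" for i
    using X that by (simp add: indep_vars_def)
  let ?S = "\<lambda>j \<omega>. stops_at n h (of_int a) (\<lambda>i. X i \<omega>) j"
  have "Measurable.pred M (\<lambda>\<omega>. stops_at n h (of_int a) (\<lambda>i\<in>{1..n}. X i \<omega>) j)" for j
    by measurable
  then have [measurable]: "Measurable.pred M (?S j)" for j
    using stops_at_restrict[of n h "of_int a"] by simp
  have stop_less: "enat k < stop_round n h (of_int a) x \<longleftrightarrow> (\<forall>j\<le>k. \<not> stops_at n h (of_int a) x j)"
    for k x
  proof -
    have "enat k < stop_round n h (of_int a) x \<longleftrightarrow>
        (\<forall>j. 1 \<le> j \<and> stops_at n h (of_int a) x j \<longrightarrow> k < j)"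
      unfolding stop_round_def Suc_ile_eq[symmetric] le_INF_iff by (auto simp: Suc_le_eq)
    also have "\<dots> \<longleftrightarrow> (\<forall>j\<le>k. \<not> stops_at n h (of_int a) x j)"
      using a stops_at_0[of n h "of_int a" x]
      by (metis One_nat_def less_eq_Suc_le linorder_not_le neq0_conv)
    finally show ?thesis .
  qed
  \<comment> \<open>Rewriting the infimum over an index set independent of \<omega> exhibits it as a
    countable infimum of measurable functions.\<close>
  have stop_eq: "stop_round n h (of_int a) (\<lambda>i. X i \<omega>) = (INF j\<in>{1..}. if ?S j \<omega> then enat j else \<infinity>)" for \<omega>
    unfolding stop_round_def
  proof (rule antisym)
    show "(INF j\<in>{j. 1 \<le> j \<and> ?S j \<omega>}. enat j) \<le> (INF j\<in>{1..}. if ?S j \<omega> then enat j else \<infinity>)"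
      by (rule INF_greatest) (auto intro: INF_lower)
    show "(INF j\<in>{1..}. if ?S j \<omega> then enat j else \<infinity>) \<le> (INF j\<in>{j. 1 \<le> j \<and> ?S j \<omega>}. enat j)"
    proof (rule INF_greatest)
      fix j assume "j \<in> {j. 1 \<le> j \<and> ?S j \<omega>}"
      then show "(INF j\<in>{1..}. if ?S j \<omega> then enat j else \<infinity>) \<le> enat j"
        by (intro INF_lower2[of j]) auto
    qed
  qed
  have "(\<lambda>\<omega>. stop_round n h (of_int a) (\<lambda>i. X i \<omega>)) \<in> measurable M (count_space UNIV)"
    unfolding stop_eq by measurable
  then have "mean_stop_round M X n h (of_int a) =
    (\<Sum>k. emeasure M {\<omega> \<in> space M. \<forall>j\<le>k. \<not> ?S j \<omega>})"
    unfolding mean_stop_round_def by (simp add: nn_integral_enat_function stop_less)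
  also have "(\<lambda>k. emeasure M {\<omega> \<in> space M. \<forall>j\<le>k. \<not> ?S j \<omega>}) = (\<lambda>k. ennreal (survival n h (of_int a) k))"
    unfolding survival_def emeasure_eq_measure
    using assms(1) by (intro ext arg_cong[where f = ennreal] measure_iid_uniform X U) (auto simp: stops_at_restrict)
  also have "(\<Sum>k. ennreal (survival n h (of_int a) k)) = ennreal (expected_rounds n h a)"
    unfolding expected_rounds_def by (intro suminf_ennreal2 survival_nonneg survival_summable h)
  finally show ?thesis .
qed

end

section \<open>Assembly of the linear system\<close>

theorem theorem1:
  fixes M :: "'a measure" and X :: "nat \<Rightarrow> 'a \<Rightarrow> real"
    and h :: "nat \<Rightarrow> int" and n m :: nat
  assumes "prob_space M"
    and "n \<ge> 2" and "m \<le> n"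
    and "\<forall>i\<in>{1..n}. h i \<in> {-1, 1}"
    and "card (pos_nodes n h) = m"
    and "prob_space.indep_vars M (\<lambda>_. borel) X {1..n}"
    and "\<forall>i\<in>{1..n}. distr M borel (X i) = uniform_measure lborel {0..<1}"
  shows "(\<forall>a\<in>{- (int n - int m) + 1..int m - 1}. mean_stop_round M X n h (of_int a) < \<infinity>)
    \<and> (\<forall>l\<ge>1. transition_mat M X n h l = transition_mat M X n h 1)
    \<and> (\<forall>l\<ge>1. (1\<^sub>m (n - 1) - transition_mat M X n h l) *\<^sub>v mean_vec M X n h
          = Matrix.vec (n - 1) (\<lambda>_. 1))"
proof -
  interpret prob_space M by fact
  have mean: "mean_stop_round M X n h (of_int a) = ennreal (expected_rounds n h a)"
    if "undecided n h (of_int a)" for a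
    using assms that by (intro mean_stop_round_eq) auto
  have undecided_threshold: "undecided n h (of_int (threshold n m k))" if "k < n - 1" for k
    using that undecided_iff_threshold[OF assms(5)] by blast
  have nonneg: "0 \<le> expected_rounds n h a" for a
    unfolding expected_rounds_def by (intro suminf_nonneg survival_summable survival_nonneg assms)
  have bit_prob: "measure M {\<omega> \<in> space M. bit_sum n h (\<lambda>i. X i \<omega>) l = c} = bit_sum_prob n h c"
    if "1 \<le> l" for l c
  proof -
    obtain l' where l: "l = Suc l'" using \<open>1 \<le> l\<close> by (cases l) auto
    show ?thesis
      unfolding l measure_bit_sum[symmetric, where l = l'] using assms
      by (intro measure_iid_uniform) (auto simp: bit_sum_restrict)
  qed
  define Q where "Q = Matrix.mat (n - 1) (n - 1)
     (\<lambda>(r, c). bit_sum_prob n h (2 * threshold n m r - threshold n m c))"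
  have Q: "transition_mat M X n h l = Q" if "1 \<le> l" for l
    by (simp add: transition_mat_def Q_def bit_prob[OF that] assms(5))
  \<comment> \<open>All means are finite here, so \<open>enn2real\<close> returns their true values
    and not its default 0 at infinity.\<close>
  have v: "mean_vec M X n h = Matrix.vec (n - 1) (\<lambda>k. expected_rounds n h (threshold n m k))"
    by (auto simp: mean_vec_def assms(5) mean undecided_threshold nonneg)
  have "(1\<^sub>m (n - 1) - Q) *\<^sub>v mean_vec M X n h = Matrix.vec (n - 1) (\<lambda>_. 1)"
  proof (rule eq_vecI)
    fix r assume "r < dim_vec (Matrix.vec (n - 1) (\<lambda>_. 1::real))"
    then have r: "r < n - 1" by simp
    have "((1\<^sub>m (n - 1) - Q) *\<^sub>v mean_vec M X n h) $ r =
      (\<Sum>k<n-1. (of_bool (r = k) - bit_sum_prob n h (2 * threshold n m r - threshold n m k)) *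
        expected_rounds n h (threshold n m k))"
      using r by (auto simp: v Q_def scalar_prod_def lessThan_atLeast0 intro!: sum.cong)
    also have "\<dots> = expected_rounds n h (threshold n m r) -
       (\<Sum>k<n-1. bit_sum_prob n h (2 * threshold n m r - threshold n m k) *
        expected_rounds n h (threshold n m k))"
      using r by (simp add: left_diff_distrib sum_subtractf of_bool_def if_distrib[of "\<lambda>x. x * _"] cong: if_cong)
    also have "\<dots> = 1"
      using expected_rounds_first_step[OF assms(4) undecided_threshold[OF r]]
        average_over_first_bits[OF assms(5), of "expected_rounds n h" "threshold n m r"]
      by (simp add: expected_rounds_eq_0)
    finally show "((1\<^sub>m (n - 1) - Q) *\<^sub>v mean_vec M X n h) $ r = Matrix.vec (n - 1) (\<lambda>_. 1) $ r"
      using r by simp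
  qed (simp add: Q_def)
  moreover have "mean_stop_round M X n h (of_int a) < \<infinity>"
    if "a \<in> {- (int n - int m) + 1..int m - 1}" for a
  proof -
    have "real m - real n < of_int a" "of_int a < real m"
      using that by auto
    then have "undecided n h (of_int a)"
      using assms(5) by (simp add: undecided_def)
    then show ?thesis by (simp add: mean)
  qed
  ultimately show ?thesis using Q by auto
qed

end
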